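(* Let $J$ be a finite group acting via automorphisms on a finite abelian group $N$, and suppose the induced semidirect product $N\rtimes J$ acts on some non-empty set $\Omega$ in such a way that the action of $N$ on $\Omega$ is transitive. If for each prime $p$ a Sylow $p$-subgroup of $J$ fixes an element of $\Omega$, then there exists an element $\omega\in\Omega$ that is fixed by every element of $J$.
   Context: $N$ and $J$ are identified with their natural images in $N\rtimes J$, so they act on $\Omega$ by restriction. A subgroup fixes an element of $\Omega$ if every element of the subgroup fixes that point; the fixed point may depend on the prime $p$. *)

theory Defs
  imports "HOL-Algebra.Algebra"
begin

text \<open>
  The homomorphism \<open>\<phi>\<close> from \<open>J\<close> to \<open>AutoGroup N\<close> is the action of \<open>J\<close> on \<open>N\<close>. The natural images
  of \<open>N\<close> and \<open>J\<close> consist of the pairs \<open>(n, \<one>\<^bsub>J\<^esub>)\<close> and \<open>(\<one>\<^bsub>N\<^esub>, j)\<close>; conjugation by the latter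
  induces \<open>\<phi> j\<close> on the former.
\<close>

definition semidirect_product ::
  "('n, 'x) monoid_scheme \<Rightarrow> ('j, 'y) monoid_scheme \<Rightarrow> ('j \<Rightarrow> 'n \<Rightarrow> 'n) \<Rightarrow> ('n \<times> 'j) monoid"
  where "semidirect_product N J \<phi> =
    \<lparr>carrier = carrier N \<times> carrier J,
     monoid.mult = (\<lambda>(m, j) (n, k). (m \<otimes>\<^bsub>N\<^esub> \<phi> j n, j \<otimes>\<^bsub>J\<^esub> k)),
     one = (\<one>\<^bsub>N\<^esub>, \<one>\<^bsub>J\<^esub>)\<rparr>"

text \<open>For a prime \<open>p\<close> not dividing the order of \<open>G\<close>, this is the trivial subgroup.\<close>

definition sylow_subgroup :: "('a, 'b) monoid_scheme \<Rightarrow> nat \<Rightarrow> 'a set \<Rightarrow> bool"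
  where "sylow_subgroup G p P \<longleftrightarrow>
    Factorial_Ring.prime p \<and> subgroup P G \<and> card P = p ^ multiplicity p (order G)"

context
  fixes N :: "('n, 'x) monoid_scheme" and J :: "('j, 'y) monoid_scheme"
    and \<phi> :: "'j \<Rightarrow> 'n \<Rightarrow> 'n"
  assumes N: "group N" and J: "group J" and \<phi>: "\<phi> \<in> hom J (AutoGroup N)"
begin

lemma semidirect_action_auto:
  assumes "j \<in> carrier J"
  shows "\<phi> j \<in> hom N N" "\<phi> j \<in> Bij (carrier N)"
  using \<phi> assms by (auto simp: hom_def AutoGroup_def auto_def)

lemma semidirect_action_closed:
  assumes "j \<in> carrier J" "n \<in> carrier N"
  shows "\<phi> j n \<in> carrier N"
  using semidirect_action_auto(1)[OF assms(1)] assms(2) by (auto simp: hom_def)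

lemma semidirect_action_mult:
  assumes "j \<in> carrier J" "k \<in> carrier J" "n \<in> carrier N"
  shows "\<phi> (j \<otimes>\<^bsub>J\<^esub> k) n = \<phi> j (\<phi> k n)"
proof -
  have "\<phi> (j \<otimes>\<^bsub>J\<^esub> k) = \<phi> j \<otimes>\<^bsub>AutoGroup N\<^esub> \<phi> k"
    using \<phi> assms by (simp add: hom_def)
  then show ?thesis
    using assms semidirect_action_auto(2) by (simp add: AutoGroup_def BijGroup_def compose_def)
qed

lemma semidirect_action_one:
  assumes "n \<in> carrier N"
  shows "\<phi> \<one>\<^bsub>J\<^esub> n = n"
proof -
  have "\<phi> \<one>\<^bsub>J\<^esub> = \<one>\<^bsub>AutoGroup N\<^esub>"
    using hom_one[OF \<phi> J group.AutoGroup[OF N]] .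
  then show ?thesis
    using assms by (simp add: AutoGroup_def BijGroup_def)
qed

lemma group_semidirect_product: "group (semidirect_product N J \<phi>)"
proof -
  interpret N: group N by (rule N)
  interpret J: group J by (rule J)
  have hom: "\<phi> j (m \<otimes>\<^bsub>N\<^esub> n) = \<phi> j m \<otimes>\<^bsub>N\<^esub> \<phi> j n"
    if "j \<in> carrier J" "m \<in> carrier N" "n \<in> carrier N" for j m n
    using semidirect_action_auto(1)[OF that(1)] that by (simp add: hom_def)
  have one: "\<phi> j \<one>\<^bsub>N\<^esub> = \<one>\<^bsub>N\<^esub>" if "j \<in> carrier J" for j
    using hom_one[OF semidirect_action_auto(1)[OF that] N N] .
  show ?thesis
  proof (rule groupI)
    fix x assume x: "x \<in> carrier (semidirect_product N J \<phi>)"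
    then obtain n j where nj: "x = (n, j)" "n \<in> carrier N" "j \<in> carrier J"
      by (auto simp: semidirect_product_def)
    let ?y = "(\<phi> (inv\<^bsub>J\<^esub> j) (inv\<^bsub>N\<^esub> n), inv\<^bsub>J\<^esub> j)"
    have "?y \<otimes>\<^bsub>semidirect_product N J \<phi>\<^esub> x = \<one>\<^bsub>semidirect_product N J \<phi>\<^esub>"
      using nj hom[of "inv\<^bsub>J\<^esub> j" "inv\<^bsub>N\<^esub> n" n] one
      by (simp add: semidirect_product_def flip: hom)
    moreover have "?y \<in> carrier (semidirect_product N J \<phi>)"
      using nj by (simp add: semidirect_product_def semidirect_action_closed)
    ultimately show "\<exists>y\<in>carrier (semidirect_product N J \<phi>).
        y \<otimes>\<^bsub>semidirect_product N J \<phi>\<^esub> x = \<one>\<^bsub>semidirect_product N J \<phi>\<^esub>"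
      by blast
  qed (auto simp: semidirect_product_def semidirect_action_closed semidirect_action_mult
      semidirect_action_one hom N.m_assoc J.m_assoc)
qed

lemma semidirect_product_embeddings:
  "(\<lambda>n. (n, \<one>\<^bsub>J\<^esub>)) \<in> hom N (semidirect_product N J \<phi>)"
  "(\<lambda>j. (\<one>\<^bsub>N\<^esub>, j)) \<in> hom J (semidirect_product N J \<phi>)"
proof -
  interpret N: group N by (rule N)
  interpret J: group J by (rule J)
  have "\<phi> j \<one>\<^bsub>N\<^esub> = \<one>\<^bsub>N\<^esub>" if "j \<in> carrier J" for j
    using hom_one[OF semidirect_action_auto(1)[OF that] N N] .
  then show "(\<lambda>n. (n, \<one>\<^bsub>J\<^esub>)) \<in> hom N (semidirect_product N J \<phi>)"
    "(\<lambda>j. (\<one>\<^bsub>N\<^esub>, j)) \<in> hom J (semidirect_product N J \<phi>)"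
    by (auto simp: hom_def semidirect_product_def semidirect_action_one)
qed

end

end

theory Submission
  imports Defs
begin

text \<open>
  Let \<open>K\<close> be the kernel of the action of \<open>N\<close> on \<open>\<Omega>\<close>. Since \<open>N\<close> is abelian and transitive, \<open>K\<close> is
  also the stabilizer of each point, so \<open>\<Omega>\<close> is an affine space over the abelian group \<open>N/K\<close>, and
  \<open>J\<close> acts on it by affine maps. In this setting a formal integer combination
  \<open>c\<^sub>1 x\<^sub>1 + \<dots> + c\<^sub>k x\<^sub>k\<close> of points is meaningful if its weight \<open>m = c\<^sub>1 + \<dots> + c\<^sub>k\<close> is recorded:
  relative to an origin \<open>\<omega>\<close>, and with \<open>N\<close> written additively, it is represented by
  \<open>s = c\<^sub>1 (x\<^sub>1 - \<omega>) + \<dots> + c\<^sub>k (x\<^sub>k - \<omega>)\<close> modulo \<open>K\<close>. Combinations of weight \<open>1\<close> are points of \<open>\<Omega>\<close>,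
  so it suffices to find one of weight \<open>1\<close> that is invariant under \<open>J\<close>.

  The sum over the \<open>J\<close>-orbit of a point is invariant, and its weight is the length of the orbit.
  If the point is fixed by a Sylow \<open>p\<close>-subgroup, then by the orbit-stabilizer theorem this weight
  is not divisible by \<open>p\<close> (\<open>orbit_length_not_dvd\<close>). The weights of invariant combinations are
  closed under subtraction (\<open>invariant_weight_diff\<close>), so they contain their greatest common
  divisor; no prime divides all of them, hence \<open>1\<close> is among them (\<open>one_mem_if_diff_closed\<close>).

  This is the averaging argument which shows that a class in \<open>H\<^sup>1(J, N/K)\<close> vanishes if its
  restrictions to all Sylow subgroups vanish. No quotient has to be formed: two elements of \<open>N\<close>
  agree modulo \<open>K\<close> exactly if they move \<open>\<omega>\<close> to the same point.
\<close>

section \<open>Sets of natural numbers closed under subtraction\<close>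

text \<open>
  The least positive member divides all others, as in Euclid's algorithm, so it cannot have a prime
  divisor. A witness for any single prime is nonzero, which provides a positive member.
\<close>

lemma one_mem_if_diff_closed:
  fixes I :: "nat set"
  assumes diff: "\<And>m n. m \<in> I \<Longrightarrow> n \<in> I \<Longrightarrow> n \<le> m \<Longrightarrow> m - n \<in> I"
    and prime: "\<And>p. Factorial_Ring.prime p \<Longrightarrow> \<exists>m\<in>I. \<not> p dvd m"
  shows "1 \<in> I"
proof -
  have "\<exists>m. m \<in> I \<and> 0 < m"
    using prime[OF two_is_prime_nat] by (metis dvd_0_right gr0I)
  define d where "d = (LEAST m. m \<in> I \<and> 0 < m)"
  have d: "d \<in> I" "0 < d"
    using LeastI_ex[OF \<open>\<exists>m. m \<in> I \<and> 0 < m\<close>] by (simp_all add: d_def)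
  have least: "d \<le> m" if "m \<in> I" "0 < m" for m
    using that by (simp add: d_def Least_le)
  have "d dvd m" if "m \<in> I" for m
    using that
  proof (induction m rule: less_induct)
    case (less m)
    show ?case
    proof (cases "m = 0")
      case False
      then have "d \<le> m"
        using least less.prems by simp
      moreover have "d dvd m - d"
        using less.IH[of "m - d"] diff[OF less.prems d(1)] d(2) \<open>d \<le> m\<close> by simp
      ultimately show ?thesis
        by (simp add: dvd_minus_self)
    qed simp
  qed
  then have "d = 1"
    using prime by (meson dvd_trans prime_factor_nat)
  then show ?thesis
    using d by simp
qed

section \<open>Orbits of points fixed by a Sylow subgroup\<close>

text \<open>
  The stabilizer of the point contains \<open>P\<close>, so its order already has the full power of \<open>p\<close> that
  divides the order of the group, and nothing is left for the orbit.
\<close>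

lemma (in group_action) orbit_length_not_dvd:
  assumes fin: "finite (carrier G)"
    and P: "sylow_subgroup G p P"
    and x: "x \<in> E"
    and fixed: "\<And>g. g \<in> P \<Longrightarrow> \<phi> g x = x"
  shows "\<not> p dvd card (orbit G \<phi> x)"
proof
  assume dvd: "p dvd card (orbit G \<phi> x)"
  interpret group G
    using group_hom group_hom.axioms(1) by auto
  let ?S = "stabilizer G \<phi> x"
  have p: "Factorial_Ring.prime p" and sub: "subgroup P G"
    and card_P: "card P = p ^ multiplicity p (order G)"
    using P by (simp_all add: sylow_subgroup_def)
  have S: "subgroup ?S G"
    using stabilizer_subgroup[OF x] .
  have "P \<subseteq> ?S"
    using fixed subgroup.subset[OF sub] by (auto simp: stabilizer_def)
  then have "subgroup P (G\<lparr>carrier := ?S\<rparr>)"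
    using subgroup_incl[OF sub S] by simp
  from group.lagrange[OF subgroup.subgroup_is_group[OF S is_group] this]
  obtain k where "k * card P = card ?S"
    by (auto simp: order_def)
  then have "card P dvd card ?S"
    by (metis dvd_triv_right)
  with dvd have "p ^ Suc (multiplicity p (order G)) dvd card (orbit G \<phi> x) * card ?S"
    unfolding card_P power_Suc by (rule mult_dvd_mono)
  then have "p ^ Suc (multiplicity p (order G)) dvd order G"
    unfolding orbit_stabilizer_theorem[OF x] .
  moreover have "order G \<noteq> 0"
    using fin order_gt_0_iff_finite by simp
  ultimately have "Suc (multiplicity p (order G)) \<le> multiplicity p (order G)"
    using p by (intro multiplicity_geI) (auto simp: prime_gt_1_nat)
  then show False
    by simp
qed

section \<open>Invariant combinations of points\<close>

text \<open>
  The group \<open>N\<close> plays the role of the translations, and the axiom \<open>equivariant\<close> says that each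
  \<open>\<beta> j\<close> is an affine map with linear part \<open>\<phi> j\<close>.
\<close>

locale affine_action =
  comm_group N + linear: transitive_action N \<Omega> \<alpha> + acting: group_action J \<Omega> \<beta>
  for N (structure) and J :: "('j, 'y) monoid_scheme" and \<Omega> :: "'w set" and \<alpha> \<beta> +
  fixes \<phi> :: "'j \<Rightarrow> 'a \<Rightarrow> 'a"
  assumes \<phi>_hom: "j \<in> carrier J \<Longrightarrow> \<phi> j \<in> hom N N"
    and equivariant:
      "j \<in> carrier J \<Longrightarrow> n \<in> carrier N \<Longrightarrow> x \<in> \<Omega> \<Longrightarrow> \<beta> j (\<alpha> n x) = \<alpha> (\<phi> j n) (\<beta> j x)"
begin

lemma \<phi>_closed [simp]: "j \<in> carrier J \<Longrightarrow> n \<in> carrier N \<Longrightarrow> \<phi> j n \<in> carrier N"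
  using \<phi>_hom by (auto simp: hom_def)

lemma \<phi>_mult:
  "j \<in> carrier J \<Longrightarrow> m \<in> carrier N \<Longrightarrow> n \<in> carrier N \<Longrightarrow> \<phi> j (m \<otimes> n) = \<phi> j m \<otimes> \<phi> j n"
  using \<phi>_hom by (auto simp: hom_def)

lemma \<phi>_one: "j \<in> carrier J \<Longrightarrow> \<phi> j \<one> = \<one>"
  using hom_one[OF \<phi>_hom] is_group by blast

lemma \<phi>_inv: "j \<in> carrier J \<Longrightarrow> n \<in> carrier N \<Longrightarrow> \<phi> j (inv n) = inv (\<phi> j n)"
  using group_hom.hom_inv[of N N "\<phi> j" n] \<phi>_hom is_group
  by (simp add: group_hom_def group_hom_axioms_def)

lemma \<phi>_finprod:
  assumes "j \<in> carrier J" "f \<in> A \<rightarrow> carrier N"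
  shows "\<phi> j (finprod N f A) = finprod N (\<lambda>x. \<phi> j (f x)) A"
  using assms(2)
proof (induction A rule: infinite_finite_induct)
  case (insert x A)
  then have "f \<in> A \<rightarrow> carrier N" "f x \<in> carrier N"
    by auto
  moreover from this have "(\<lambda>x. \<phi> j (f x)) \<in> A \<rightarrow> carrier N"
    using assms(1) by (auto simp: Pi_def)
  ultimately show ?case
    using insert assms(1) by (simp add: \<phi>_mult)
qed (simp_all add: \<phi>_one assms(1))

text \<open>
  Equality of the images of \<open>x\<close> is congruence modulo the stabilizer of \<open>x\<close>. The next three lemmas
  show that it is compatible with the operations of \<open>N\<close> and so replace computations in the
  quotient.
\<close>

lemma move_mult_cong:
  assumes "x \<in> \<Omega>" "a \<in> carrier N" "b \<in> carrier N" "c \<in> carrier N" "d \<in> carrier N"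
    and ab: "\<alpha> a x = \<alpha> b x" and cd: "\<alpha> c x = \<alpha> d x"
  shows "\<alpha> (a \<otimes> c) x = \<alpha> (b \<otimes> d) x"
proof -
  have "\<alpha> (a \<otimes> c) x = \<alpha> (a \<otimes> d) x"
    using assms by (simp add: linear.composition_rule)
  also have "a \<otimes> d = d \<otimes> a"
    using assms by (intro m_comm)
  also have "\<alpha> \<dots> x = \<alpha> (d \<otimes> b) x"
    using assms by (simp add: linear.composition_rule)
  also have "d \<otimes> b = b \<otimes> d"
    using assms by (intro m_comm)
  finally show ?thesis .
qed

lemma move_inv_cong:
  assumes "x \<in> \<Omega>" "a \<in> carrier N" "b \<in> carrier N" and ab: "\<alpha> a x = \<alpha> b x"
  shows "\<alpha> (inv a) x = \<alpha> (inv b) x"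
proof -
  have "\<alpha> (inv a) x = \<alpha> (inv a \<otimes> (inv b \<otimes> b)) x"
    using assms by simp
  also have "inv a \<otimes> (inv b \<otimes> b) = inv b \<otimes> (inv a \<otimes> b)"
    using assms by (intro m_lcomm) simp_all
  also have "\<alpha> \<dots> x = \<alpha> (inv b \<otimes> (inv a \<otimes> a)) x"
    using assms by (intro move_mult_cong refl) simp_all
  also have "\<dots> = \<alpha> (inv b) x"
    using assms by simp
  finally show ?thesis .
qed

lemma move_finprod_cong:
  assumes "x \<in> \<Omega>" "f \<in> A \<rightarrow> carrier N" "g \<in> A \<rightarrow> carrier N"
    and "\<And>y. y \<in> A \<Longrightarrow> \<alpha> (f y) x = \<alpha> (g y) x"
  shows "\<alpha> (finprod N f A) x = \<alpha> (finprod N g A) x"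
  using assms(2-)
proof (induction A rule: infinite_finite_induct)
  case (insert y A)
  then have "f \<in> A \<rightarrow> carrier N" "g \<in> A \<rightarrow> carrier N" "f y \<in> carrier N" "g y \<in> carrier N"
    by auto
  with insert show ?case
    by (simp add: move_mult_cong assms(1))
qed simp_all

text \<open>
  Some formal combination of points has weight \<open>m\<close> and is invariant under \<open>J\<close>. If \<open>s\<close> represents
  a combination of weight \<open>m\<close> relative to the origin \<open>\<omega>\<close>, then applying \<open>j\<close> gives the combination
  represented by \<open>\<phi> j s\<close> relative to the origin \<open>\<beta> j \<omega>\<close>. Going back to the origin \<open>\<omega>\<close> adds the
  difference \<open>a\<close> of the two origins \<open>m\<close> times. The quantification over all such \<open>a\<close> avoids choosing
  one for each \<open>j\<close>.
\<close>

definition invariant_weight :: "'w \<Rightarrow> nat \<Rightarrow> bool"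
  where "invariant_weight \<omega> m \<longleftrightarrow>
    (\<exists>s\<in>carrier N. \<forall>j\<in>carrier J. \<forall>a\<in>carrier N.
      \<alpha> a \<omega> = \<beta> j \<omega> \<longrightarrow> \<alpha> (\<phi> j s \<otimes> a [^] m) \<omega> = \<alpha> s \<omega>)"

text \<open>
  The difference of two invariant combinations is invariant; the restriction to \<open>n \<le> m\<close> only keeps
  its weight a natural number.
\<close>

lemma invariant_weight_diff:
  assumes \<omega>: "\<omega> \<in> \<Omega>"
    and "invariant_weight \<omega> m" "invariant_weight \<omega> n" and "n \<le> m"
  shows "invariant_weight \<omega> (m - n)"
proof -
  obtain s where s: "s \<in> carrier N"
    "\<And>j a. j \<in> carrier J \<Longrightarrow> a \<in> carrier N \<Longrightarrow> \<alpha> a \<omega> = \<beta> j \<omega> \<Longrightarrow>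
      \<alpha> (\<phi> j s \<otimes> a [^] m) \<omega> = \<alpha> s \<omega>"
    using assms(2) unfolding invariant_weight_def by blast
  obtain t where t: "t \<in> carrier N"
    "\<And>j a. j \<in> carrier J \<Longrightarrow> a \<in> carrier N \<Longrightarrow> \<alpha> a \<omega> = \<beta> j \<omega> \<Longrightarrow>
      \<alpha> (\<phi> j t \<otimes> a [^] n) \<omega> = \<alpha> t \<omega>"
    using assms(3) unfolding invariant_weight_def by blast
  have "\<alpha> (\<phi> j (s \<otimes> inv t) \<otimes> a [^] (m - n)) \<omega> = \<alpha> (s \<otimes> inv t) \<omega>"
    if j: "j \<in> carrier J" and a: "a \<in> carrier N" "\<alpha> a \<omega> = \<beta> j \<omega>" for j a
  proof -
    have "a [^] m = a [^] (m - n) \<otimes> a [^] n"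
      using a \<open>n \<le> m\<close> by (simp add: nat_pow_mult)
    then have power: "a [^] (m - n) = a [^] m \<otimes> inv (a [^] n)"
      using a by (simp add: m_assoc)
    have "\<phi> j (s \<otimes> inv t) \<otimes> a [^] (m - n)
        = (\<phi> j s \<otimes> a [^] m) \<otimes> inv (\<phi> j t \<otimes> a [^] n)"
      unfolding power using j a s(1) t(1) by (simp add: \<phi>_mult \<phi>_inv inv_mult m_ac)
    moreover have "\<alpha> (inv (\<phi> j t \<otimes> a [^] n)) \<omega> = \<alpha> (inv t) \<omega>"
      using j a t \<omega> by (intro move_inv_cong) simp_all
    ultimately show ?thesis
      using j a s t \<omega> by (simp add: move_mult_cong)
  qed
  then show ?thesis
    unfolding invariant_weight_def using s(1) t(1) by (intro bexI[of _ "s \<otimes> inv t"]) auto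
qed

text \<open>The points of \<open>A\<close> are permuted by \<open>J\<close>, which does not change their sum.\<close>

lemma invariant_weight_card:
  assumes \<omega>: "\<omega> \<in> \<Omega>" and fin: "finite A" and A: "A \<subseteq> \<Omega>"
    and inv: "\<And>j. j \<in> carrier J \<Longrightarrow> \<beta> j ` A \<subseteq> A"
  shows "invariant_weight \<omega> (card A)"
proof -
  have "\<forall>x\<in>A. \<exists>n\<in>carrier N. \<alpha> n \<omega> = x"
    using linear.unique_orbit \<omega> A by blast
  then obtain t where t: "\<And>x. x \<in> A \<Longrightarrow> t x \<in> carrier N" "\<And>x. x \<in> A \<Longrightarrow> \<alpha> (t x) \<omega> = x"
    by metis
  have t_Pi: "t \<in> A \<rightarrow> carrier N"
    using t by blast
  have "\<alpha> (\<phi> j (finprod N t A) \<otimes> a [^] card A) \<omega> = \<alpha> (finprod N t A) \<omega>"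
    if j: "j \<in> carrier J" and a: "a \<in> carrier N" "\<alpha> a \<omega> = \<beta> j \<omega>" for j a
  proof -
    have inj: "inj_on (\<beta> j) A"
      using acting.inj_prop[OF j] A by (rule inj_on_subset)
    then have perm: "\<beta> j ` A = A"
      using endo_inj_surj[OF fin inv[OF j]] by blast
    have shifted: "(\<lambda>x. \<phi> j (t x)) \<in> A \<rightarrow> carrier N" "(\<lambda>x. a) \<in> A \<rightarrow> carrier N"
      using j a t by auto
    have "\<phi> j (finprod N t A) \<otimes> a [^] card A = finprod N (\<lambda>x. \<phi> j (t x) \<otimes> a) A"
      using j a t_Pi shifted by (simp add: \<phi>_finprod finprod_const)
    also have "\<alpha> \<dots> \<omega> = \<alpha> (finprod N (\<lambda>x. t (\<beta> j x)) A) \<omega>"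
    proof (rule move_finprod_cong[OF \<omega>])
      show "(\<lambda>x. \<phi> j (t x) \<otimes> a) \<in> A \<rightarrow> carrier N"
        using j a t by auto
      show "(\<lambda>x. t (\<beta> j x)) \<in> A \<rightarrow> carrier N"
        using t inv[OF j] by auto
    next
      fix x assume x: "x \<in> A"
      have "\<alpha> (\<phi> j (t x) \<otimes> a) \<omega> = \<alpha> (\<phi> j (t x)) (\<beta> j \<omega>)"
        using j a t(1)[OF x] \<omega> by (simp add: linear.composition_rule)
      also have "\<dots> = \<beta> j x"
        using equivariant[OF j t(1)[OF x] \<omega>] t(2)[OF x] by simp
      also have "\<dots> = \<alpha> (t (\<beta> j x)) \<omega>"
        using t(2) inv[OF j] x by auto
      finally show "\<alpha> (\<phi> j (t x) \<otimes> a) \<omega> = \<alpha> (t (\<beta> j x)) \<omega>" .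
    qed
    also have "finprod N (\<lambda>x. t (\<beta> j x)) A = finprod N t (\<beta> j ` A)"
      using finprod_reindex[of t "\<beta> j" A] t_Pi perm inj by simp
    finally show ?thesis
      using perm by simp
  qed
  then show ?thesis
    unfolding invariant_weight_def using finprod_closed[OF t_Pi] by blast
qed

text \<open>A combination of weight \<open>1\<close> is the single point obtained by moving the origin by \<open>s\<close>.\<close>

lemma fixed_point_if_invariant_weight_1:
  assumes \<omega>: "\<omega> \<in> \<Omega>" and "invariant_weight \<omega> 1"
  shows "\<exists>x\<in>\<Omega>. \<forall>j\<in>carrier J. \<beta> j x = x"
proof -
  obtain s where s: "s \<in> carrier N"
    "\<And>j a. j \<in> carrier J \<Longrightarrow> a \<in> carrier N \<Longrightarrow> \<alpha> a \<omega> = \<beta> j \<omega> \<Longrightarrow>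
      \<alpha> (\<phi> j s \<otimes> a) \<omega> = \<alpha> s \<omega>"
    using assms(2) unfolding invariant_weight_def by auto
  have "\<beta> j (\<alpha> s \<omega>) = \<alpha> s \<omega>" if j: "j \<in> carrier J" for j
  proof -
    obtain a where a: "a \<in> carrier N" "\<alpha> a \<omega> = \<beta> j \<omega>"
      using linear.unique_orbit[OF \<omega> acting.element_image[OF j \<omega> refl]] by blast
    have "\<beta> j (\<alpha> s \<omega>) = \<alpha> (\<phi> j s \<otimes> a) \<omega>"
      using j a s(1) \<omega> by (simp add: equivariant linear.composition_rule)
    then show ?thesis
      using s(2)[OF j a] by simp
  qed
  then show ?thesis
    using linear.element_image[OF s(1) \<omega> refl] by blast
qed

theorem fixed_point_if_sylow_fixed_points:
  assumes ne: "\<Omega> \<noteq> {}" and fin: "finite (carrier J)"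
    and sylow: "\<And>p. Factorial_Ring.prime p \<Longrightarrow>
      \<exists>P. sylow_subgroup J p P \<and> (\<exists>x\<in>\<Omega>. \<forall>j\<in>P. \<beta> j x = x)"
  shows "\<exists>x\<in>\<Omega>. \<forall>j\<in>carrier J. \<beta> j x = x"
proof -
  obtain \<omega> where \<omega>: "\<omega> \<in> \<Omega>"
    using ne by blast
  have "1 \<in> Collect (invariant_weight \<omega>)"
  proof (rule one_mem_if_diff_closed)
    fix p :: nat assume p: "Factorial_Ring.prime p"
    obtain P x where P: "sylow_subgroup J p P" and x: "x \<in> \<Omega>" "\<And>j. j \<in> P \<Longrightarrow> \<beta> j x = x"
      using sylow[OF p] by blast
    let ?A = "orbit J \<beta> x"
    have "finite ?A"
      using fin by (simp add: orbit_def setcompr_eq_image)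
    moreover have "?A \<subseteq> \<Omega>"
      using acting.element_image[OF _ x(1) refl] by (auto simp: orbit_def)
    moreover have "\<beta> j ` ?A \<subseteq> ?A" if j: "j \<in> carrier J" for j
    proof -
      interpret J: group J
        using acting.group_hom group_hom.axioms(1) by auto
      have "\<beta> j (\<beta> k x) \<in> ?A" if "k \<in> carrier J" for k
        using acting.composition_rule[OF x(1) j that] j that J.m_closed
        unfolding orbit_def by (metis (mono_tags, lifting) mem_Collect_eq)
      then show ?thesis
        unfolding orbit_def by auto
    qed
    ultimately have "invariant_weight \<omega> (card ?A)"
      by (rule invariant_weight_card[OF \<omega>])
    then show "\<exists>m\<in>Collect (invariant_weight \<omega>). \<not> p dvd m"
      using acting.orbit_length_not_dvd[OF fin P x] by blast
  qed (use invariant_weight_diff[OF \<omega>] in auto)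
  then show ?thesis
    using fixed_point_if_invariant_weight_1[OF \<omega>] by simp
qed

end

section \<open>Fixed points of the complement\<close>

theorem theorem1:
  fixes N :: "('n, 'x) monoid_scheme" and J :: "('j, 'y) monoid_scheme"
    and \<phi> :: "'j \<Rightarrow> 'n \<Rightarrow> 'n"
    and \<Omega> :: "'w set" and \<psi> :: "'n \<times> 'j \<Rightarrow> 'w \<Rightarrow> 'w"
  assumes "group J" and "finite (carrier J)"
    and "comm_group N" and "finite (carrier N)"
    and "\<phi> \<in> hom J (AutoGroup N)"
    and "\<Omega> \<noteq> {}"
    and "group_action (semidirect_product N J \<phi>) \<Omega> \<psi>"
    and "transitive_action N \<Omega> (\<lambda>n. \<psi> (n, \<one>\<^bsub>J\<^esub>))"
    and "\<And>p::nat. Factorial_Ring.prime p \<Longrightarrow>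
           \<exists>P. sylow_subgroup J p P \<and> (\<exists>\<omega>\<in>\<Omega>. \<forall>j\<in>P. \<psi> (\<one>\<^bsub>N\<^esub>, j) \<omega> = \<omega>)"
  shows "\<exists>\<omega>\<in>\<Omega>. \<forall>j\<in>carrier J. \<psi> (\<one>\<^bsub>N\<^esub>, j) \<omega> = \<omega>"
proof -
  let ?S = "semidirect_product N J \<phi>"
  interpret J: group J by (rule assms(1))
  interpret N: comm_group N by (rule assms(3))
  interpret S: group_action ?S \<Omega> \<psi> by (rule assms(7))
  note data = N.is_group J.is_group assms(5)
  note embed = semidirect_product_embeddings[OF data]
  have carrier: "(n, j) \<in> carrier ?S" if "n \<in> carrier N" "j \<in> carrier J" for n j
    using that by (simp add: semidirect_product_def)
  have "(\<psi> \<circ> (\<lambda>j. (\<one>\<^bsub>N\<^esub>, j))) \<in> hom J (BijGroup \<Omega>)"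
    using hom_compose[OF embed(2) group_hom.homh[OF S.group_hom]] .
  then have acting: "group_action J \<Omega> (\<lambda>j. \<psi> (\<one>\<^bsub>N\<^esub>, j))"
    using J.is_group group_BijGroup
    by (simp add: group_action_def group_hom_def group_hom_axioms_def comp_def)
  have "affine_action N J \<Omega> (\<lambda>n. \<psi> (n, \<one>\<^bsub>J\<^esub>)) (\<lambda>j. \<psi> (\<one>\<^bsub>N\<^esub>, j)) \<phi>"
  proof (intro affine_action.intro affine_action_axioms.intro)
    fix j assume j: "j \<in> carrier J"
    show hom: "\<phi> j \<in> hom N N"
      using semidirect_action_auto(1)[OF data j] .
    fix n x assume n: "n \<in> carrier N" and x: "x \<in> \<Omega>"
    have closed: "\<phi> j n \<in> carrier N"
      using semidirect_action_closed[OF data j n] .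
    (* Conjugation by j acts on N as its automorphism, which makes j an affine map. *)
    have "(\<one>\<^bsub>N\<^esub>, j) \<otimes>\<^bsub>?S\<^esub> (n, \<one>\<^bsub>J\<^esub>) = (\<phi> j n, \<one>\<^bsub>J\<^esub>) \<otimes>\<^bsub>?S\<^esub> (\<one>\<^bsub>N\<^esub>, j)"
      using j n closed by (simp add: semidirect_product_def semidirect_action_one[OF data])
    then show "\<psi> (\<one>\<^bsub>N\<^esub>, j) (\<psi> (n, \<one>\<^bsub>J\<^esub>) x) = \<psi> (\<phi> j n, \<one>\<^bsub>J\<^esub>) (\<psi> (\<one>\<^bsub>N\<^esub>, j) x)"
      using S.composition_rule[OF x carrier[OF N.one_closed j] carrier[OF n J.one_closed]]
        S.composition_rule[OF x carrier[OF closed J.one_closed] carrier[OF N.one_closed j]]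
      by simp
  qed (fact assms acting)+
  then show ?thesis
    by (rule affine_action.fixed_point_if_sylow_fixed_points) (fact assms)+
qed

end
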